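(* Let $\ell_1,\dots,\ell_n$ be a sequence of $n$ doubly transitive lines through the origin with span $\mathbb{C}^d$, and let $\varphi_i\in\ell_i$ be a unit-norm representative of $\ell_i$ for each $i\in[n]$. Then: (a) There exists $\beta$ such that $|\langle\varphi_i,\varphi_j\rangle|^2=\beta$ for every $i,j\in[n]$ with $i\neq j$. (b) If $n>d$, then there exists $\alpha$ such that $\sum_{i\in[n]}\varphi_i\varphi_i^*=\alpha I$.
   Context: $[n]=\{1,\dots,n\}$. A line is a one-dimensional complex subspace of $\mathbb{C}^d$; the span of a sequence of lines is the smallest subspace containing all of them. An automorphism of a sequence of lines $\{\ell_i\}_{i\in[n]}$ in $\mathbb{C}^d$ is a permutation $\sigma\in S_n$ for which there exists a unitary $Q\in\mathrm{U}(d)$ with $Q\ell_i=\ell_{\sigma(i)}$ for every $i\in[n]$. The lines are doubly transitive if their group of automorphisms acts doubly transitively on $[n]$, i.e., for all $x_1,x_2,y_1,y_2\in[n]$ with $x_1\ne x_2$ and $y_1\ne y_2$ there is an automorphism $\sigma$ with $\sigma(x_1)=y_1$ and $\sigma(x_2)=y_2$. *)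

theory Defs
  imports "HOL-Analysis.Analysis" "HOL-Combinatorics.Permutations"
begin

text \<open>
  The space \<open>\<complex>\<^sup>d\<close> is \<^typ>\<open>complex ^ 'd\<close> with \<open>d = CARD('d)\<close>. Complex-linear notions
  on it are the ones with prefix \<open>vec\<close> (\<^const>\<open>vec.subspace\<close>, \<^const>\<open>vec.span\<close>,
  \<^const>\<open>vec.dim\<close>); the unqualified constants \<open>subspace\<close>, \<open>span\<close>, \<open>dim\<close> are real-linear,
  and \<open>\<bullet>\<close> is the real part of the Hermitian inner product.
\<close>

definition cinner :: "complex ^ 'd \<Rightarrow> complex ^ 'd \<Rightarrow> complex" where
  "cinner x y = (\<Sum>k\<in>UNIV. x $ k * cnj (y $ k))"

definition adjoint_matrix :: "complex ^ 'm ^ 'n \<Rightarrow> complex ^ 'n ^ 'm" where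
  "adjoint_matrix A = (\<chi> i j. cnj (A $ j $ i))"

definition unitary_matrix :: "complex ^ 'd ^ 'd \<Rightarrow> bool" where
  "unitary_matrix Q \<longleftrightarrow> adjoint_matrix Q ** Q = mat 1 \<and> Q ** adjoint_matrix Q = mat 1"

text \<open>The rank-one matrix \<open>x x\<^sup>*\<close> of a column vector \<open>x\<close>.\<close>

definition outer_self :: "complex ^ 'd \<Rightarrow> complex ^ 'd ^ 'd" where
  "outer_self x = (\<chi> i j. x $ i * cnj (x $ j))"

definition is_line :: "(complex ^ 'd) set \<Rightarrow> bool" where
  "is_line L \<longleftrightarrow> vec.subspace L \<and> vec.dim L = 1"

text \<open>
  A sequence of \<open>n\<close> lines is a function on \<^typ>\<open>nat\<close> whose values matter only on
  \<open>{1..n}\<close>. Repeated lines are allowed.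
\<close>

definition line_automorphism ::
    "nat \<Rightarrow> (nat \<Rightarrow> (complex ^ 'd) set) \<Rightarrow> (nat \<Rightarrow> nat) \<Rightarrow> bool" where
  "line_automorphism n l \<sigma> \<longleftrightarrow>
     \<sigma> permutes {1..n} \<and>
     (\<exists>Q. unitary_matrix Q \<and> (\<forall>i\<in>{1..n}. (\<lambda>x. Q *v x) ` l i = l (\<sigma> i)))"

definition doubly_transitive_lines :: "nat \<Rightarrow> (nat \<Rightarrow> (complex ^ 'd) set) \<Rightarrow> bool" where
  "doubly_transitive_lines n l \<longleftrightarrow>
     (\<forall>i\<in>{1..n}. is_line (l i)) \<and>
     (\<forall>x1\<in>{1..n}. \<forall>x2\<in>{1..n}. \<forall>y1\<in>{1..n}. \<forall>y2\<in>{1..n}.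
        x1 \<noteq> x2 \<longrightarrow> y1 \<noteq> y2 \<longrightarrow>
        (\<exists>\<sigma>. line_automorphism n l \<sigma> \<and> \<sigma> x1 = y1 \<and> \<sigma> x2 = y2))"

end

theory Submission
  imports Defs
begin

text \<open>
  Write \<open>G\<close> for the Gram matrix of the \<open>\<phi> i\<close>. An automorphism \<open>\<sigma>\<close> supplies phases \<open>c i\<close> with
  \<open>G i j = c i * cnj (c j) * G (\<sigma> i) (\<sigma> j)\<close>, and \<open>G\<^sup>2\<close> obeys the same rule. Hence the modulus
  of an off-diagonal entry of \<open>G\<close>, the diagonal entries of \<open>G\<^sup>2\<close> and, when \<open>G\<close> is not diagonal, the
  ratio of corresponding off-diagonal entries of \<open>G\<^sup>2\<close> and \<open>G\<close> are constant. So
  \<open>G\<^sup>2 = r G + e I\<close>. If \<open>n > d\<close> then \<open>G\<close> is singular, which forces \<open>e = 0\<close>; writing \<open>S\<close> for the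
  sum of the projections, \<open>G\<^sup>2 = r G\<close> says that all \<open>S \<phi>\<^sub>i - r \<phi>\<^sub>i\<close> are orthogonal to the spanning
  family \<open>\<phi>\<close>, so \<open>S = r I\<close>.
\<close>

lemma cinner_diff_left: "cinner (x - y) z = cinner x z - cinner y z"
  by (simp add: cinner_def left_diff_distrib sum_subtractf)

lemma cinner_add_right: "cinner x (y + z) = cinner x y + cinner x z"
  by (simp add: cinner_def distrib_left sum.distrib)

lemma cinner_scale_left: "cinner (a *s x) y = a * cinner x y"
  by (simp add: cinner_def sum_distrib_left mult.assoc)

lemma cinner_scale_right: "cinner x (a *s y) = cnj a * cinner x y"
  by (simp add: cinner_def sum_distrib_left algebra_simps)

lemma cinner_sum_left: "cinner (\<Sum>i\<in>I. f i) y = (\<Sum>i\<in>I. cinner (f i) y)"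
  unfolding cinner_def sum_component sum_distrib_right by (rule sum.swap)

lemma cinner_self: "cinner x x = of_real ((norm x)\<^sup>2)"
  by (simp add: cinner_def norm_vec_def L2_set_def sum_nonneg complex_norm_square
      del: of_real_power)

lemma cinner_self_eq_0_iff: "cinner x x = 0 \<longleftrightarrow> x = 0"
  by (simp add: cinner_self)

lemma cinner_adjoint: "cinner (A *v x) y = cinner x (adjoint_matrix A *v y)"
  unfolding cinner_def adjoint_matrix_def matrix_vector_mult_def
  by (simp add: sum_distrib_left sum_distrib_right mult_ac, subst sum.swap, rule refl)

lemma cinner_unitary:
  assumes "unitary_matrix Q"
  shows "cinner (Q *v x) (Q *v y) = cinner x y"
  using assms by (simp add: cinner_adjoint matrix_vector_mul_assoc unitary_matrix_def)

lemma outer_self_mult_vec: "outer_self x *v y = cinner y x *s x"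
  by (simp add: outer_self_def matrix_vector_mult_def cinner_def vec_eq_iff
      sum_distrib_left sum_distrib_right mult_ac)

lemma sum_matrix_vector_mult: "(\<Sum>i\<in>I. A i) *v x = (\<Sum>i\<in>I. A i *v (x :: complex ^ 'd))"
  by (induction I rule: infinite_finite_induct)
    (simp_all add: matrix_vector_mult_add_rdistrib)

lemma mat_mult_vec: "mat a *v x = a *s (x :: complex ^ 'd)"
proof -
  \<comment> \<open>Pushing the factor into the conditional lets the sum over \<open>j\<close>
    collapse to its diagonal term.\<close>
  have "(if i = j then a else 0) * y = (if i = j then a * y else 0)" for i j :: 'd and y
    by simp
  then show ?thesis
    by (simp add: vec_eq_iff matrix_vector_mult_def mat_def)
qed

lemma subspace_cinner_right: "vec.subspace {y. cinner x y = 0}"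
  by (rule vec.subspaceI) (simp_all add: cinner_add_right cinner_scale_right,
      simp add: cinner_def)

lemma orthogonal_to_spanning_imp_0:
  assumes "vec.span B = UNIV" "\<And>y. y \<in> B \<Longrightarrow> cinner x y = 0"
  shows "x = 0"
proof -
  have "vec.span B \<subseteq> {y. cinner x y = 0}"
    using assms(2) by (intro vec.span_minimal subspace_cinner_right) auto
  then show ?thesis
    using assms(1) cinner_self_eq_0_iff[of x] by auto
qed

text \<open>A \<open>\<phi> i\<close> in the span of the other vectors would be orthogonal to
  \<open>\<psi> i\<close>, but the two pair to \<open>e\<close>. The case
  \<open>\<psi> = \<phi>\<close> bounds orthonormal families; another choice of
  \<open>\<psi>\<close> will force \<open>e = 0\<close>.\<close>

lemma biorthogonal_card_le:
  fixes \<phi> \<psi> :: "'a \<Rightarrow> complex ^ 'd"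
  assumes "e \<noteq> 0"
    and "\<And>i j. i \<in> I \<Longrightarrow> j \<in> I \<Longrightarrow> cinner (\<psi> i) (\<phi> j) = (if i = j then e else 0)"
  shows "card I \<le> CARD('d)"
proof -
  \<comment> \<open>Independence concerns the set of values, so repetitions are excluded separately:
    \<open>\<phi> i = \<phi> j\<close> with distinct indices would give
    \<open>e = 0\<close>.\<close>
  have inj: "inj_on \<phi> I"
    using assms by (intro inj_onI) metis
  have "vec.independent (\<phi> ` I)"
    unfolding vec.dependent_def
  proof clarify
    fix i assume i: "i \<in> I" "\<phi> i \<in> vec.span (\<phi> ` I - {\<phi> i})"
    have "vec.span (\<phi> ` I - {\<phi> i}) \<subseteq> {y. cinner (\<psi> i) y = 0}"
      using assms(2) i(1) by (intro vec.span_minimal subspace_cinner_right) auto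
    then have "cinner (\<psi> i) (\<phi> i) = 0"
      using i(2) by auto
    then show False
      using assms i(1) by simp
  qed
  then have "card (\<phi> ` I) \<le> vec.dim (UNIV :: (complex ^ 'd) set)"
    by (intro vec.independent_card_le_dim) auto
  then show ?thesis
    by (simp add: card_image[OF inj] card_cart_basis vec.dim_UNIV)
qed

lemma is_line_eq_span:
  assumes "is_line L" "x \<in> L" "x \<noteq> 0"
  shows "L = vec.span {x}"
proof
  have "vec.independent {x}"
    using assms(3) by simp
  then show "L \<subseteq> vec.span {x}"
    using assms by (intro vec.card_ge_dim_independent) (auto simp: is_line_def)
  show "vec.span {x} \<subseteq> L"
    using assms by (intro vec.span_minimal) (auto simp: is_line_def)
qed

text \<open>The unitary takes \<open>\<phi> i\<close> into the line of
  \<open>\<phi> (\<sigma> i)\<close>, so it multiplies representatives by scalars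
  \<open>c i\<close>. Preservation of inner products gives the Gram rule, whose diagonal case makes
  the scalars unimodular.\<close>

lemma line_automorphism_phases:
  fixes \<phi> :: "nat \<Rightarrow> complex ^ 'd"
  assumes aut: "line_automorphism n l \<sigma>"
    and line: "\<And>i. i \<in> {1..n} \<Longrightarrow> is_line (l i)"
    and mem: "\<And>i. i \<in> {1..n} \<Longrightarrow> \<phi> i \<in> l i"
    and unit: "\<And>i. i \<in> {1..n} \<Longrightarrow> norm (\<phi> i) = 1"
  obtains c where "\<And>i. i \<in> {1..n} \<Longrightarrow> c i * cnj (c i) = 1"
    and "\<And>i j. i \<in> {1..n} \<Longrightarrow> j \<in> {1..n} \<Longrightarrow>
           cinner (\<phi> i) (\<phi> j) = c i * cnj (c j) * cinner (\<phi> (\<sigma> i)) (\<phi> (\<sigma> j))"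
proof -
  obtain Q where perm: "\<sigma> permutes {1..n}" and Q: "unitary_matrix Q"
    and img: "\<And>i. i \<in> {1..n} \<Longrightarrow> (\<lambda>x. Q *v x) ` l i = l (\<sigma> i)"
    using aut by (auto simp: line_automorphism_def)
  have "\<exists>a. Q *v \<phi> i = a *s \<phi> (\<sigma> i)" if i: "i \<in> {1..n}" for i
  proof -
    have s: "\<sigma> i \<in> {1..n}"
      using permutes_in_image[OF perm] i by blast
    then have "\<phi> (\<sigma> i) \<noteq> 0"
      using unit by fastforce
    then have "l (\<sigma> i) = vec.span {\<phi> (\<sigma> i)}"
      using s by (intro is_line_eq_span line mem)
    moreover have "Q *v \<phi> i \<in> l (\<sigma> i)"
      using img[OF i] mem[OF i] by blast
    ultimately show ?thesis
      by (auto simp: vec.span_singleton)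
  qed
  then obtain c where c: "\<And>i. i \<in> {1..n} \<Longrightarrow> Q *v \<phi> i = c i *s \<phi> (\<sigma> i)"
    by metis
  have gram: "cinner (\<phi> i) (\<phi> j) = c i * cnj (c j) * cinner (\<phi> (\<sigma> i)) (\<phi> (\<sigma> j))"
    if "i \<in> {1..n}" "j \<in> {1..n}" for i j
    using cinner_unitary[OF Q, of "\<phi> i" "\<phi> j"] c that
    by (simp add: cinner_scale_left cinner_scale_right mult_ac)
  have "c i * cnj (c i) = 1" if i: "i \<in> {1..n}" for i
  proof -
    have "\<sigma> i \<in> {1..n}"
      using permutes_in_image[OF perm] i by blast
    then show ?thesis
      using gram[OF i i] unit i by (simp add: cinner_self)
  qed
  then show thesis
    using gram that by blast
qed

text \<open>The sums are the entries of \<open>G\<^sup>2\<close>, and entry \<open>(i, j)\<close> is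
  also \<open>cinner (S *v \<phi> i) (\<phi> j)\<close>. Hence the vectors
  \<open>S *v \<phi> i - r *s \<phi> i\<close> are biorthogonal to \<open>\<phi>\<close> with
  constant \<open>e\<close>, which is impossible for \<open>e \<noteq> 0\<close> with more than
  \<open>d\<close> vectors.\<close>

lemma sum_outer_self_eq_mat:
  fixes \<phi> :: "'a \<Rightarrow> complex ^ 'd"
  assumes span: "vec.span (\<phi> ` I) = UNIV" and card: "card I > CARD('d)"
    and off: "\<And>i j. i \<in> I \<Longrightarrow> j \<in> I \<Longrightarrow> i \<noteq> j \<Longrightarrow>
      (\<Sum>k\<in>I. cinner (\<phi> i) (\<phi> k) * cinner (\<phi> k) (\<phi> j)) = r * cinner (\<phi> i) (\<phi> j)"
    and diag: "\<And>i. i \<in> I \<Longrightarrow>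
      (\<Sum>k\<in>I. cinner (\<phi> i) (\<phi> k) * cinner (\<phi> k) (\<phi> i)) = r * cinner (\<phi> i) (\<phi> i) + e"
  shows "(\<Sum>i\<in>I. outer_self (\<phi> i)) = mat r"
proof -
  define S where "S = (\<Sum>i\<in>I. outer_self (\<phi> i))"
  define \<psi> where "\<psi> x = S *v x - r *s x" for x
  have \<psi>: "cinner (\<psi> (\<phi> i)) (\<phi> j) = (if i = j then e else 0)" if "i \<in> I" "j \<in> I" for i j
    using off[OF that] diag[OF that(1)]
    by (auto simp: \<psi>_def S_def cinner_diff_left cinner_scale_left sum_matrix_vector_mult
        outer_self_mult_vec cinner_sum_left)
  then have "e = 0"
    using biorthogonal_card_le[of e I "\<lambda>i. \<psi> (\<phi> i)" \<phi>] card by fastforce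
  then have "\<psi> (\<phi> i) = 0" if "i \<in> I" for i
    using \<psi> that by (intro orthogonal_to_spanning_imp_0[OF span]) auto
  \<comment> \<open>Linearity of \<open>\<psi>\<close> carries its vanishing from the
    \<open>\<phi> i\<close> to their span.\<close>
  moreover have "vec.subspace {x. \<psi> x = 0}"
    by (rule vec.subspaceI)
      (auto simp: \<psi>_def matrix_vector_right_distrib vec.scale_right_distrib
        vector_scalar_commute vec.scale_left_commute)
  ultimately have "vec.span (\<phi> ` I) \<subseteq> {x. \<psi> x = 0}"
    by (intro vec.span_minimal) auto
  then have "S *v x = mat r *v x" for x
    using span by (auto simp: \<psi>_def mat_mult_vec)
  then show ?thesis
    unfolding S_def[symmetric] by (simp add: matrix_eq)
qed

lemma span_representatives:
  assumes "vec.span (\<Union>i\<in>I. l i) = UNIV"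
    and "\<And>i. i \<in> I \<Longrightarrow> is_line (l i)" "\<And>i. i \<in> I \<Longrightarrow> \<phi> i \<in> l i" "\<And>i. i \<in> I \<Longrightarrow> \<phi> i \<noteq> 0"
  shows "vec.span (\<phi> ` I) = UNIV"
proof -
  have "l i \<subseteq> vec.span (\<phi> ` I)" if "i \<in> I" for i
    using is_line_eq_span[of "l i" "\<phi> i"] assms(2-4) that
      vec.span_mono[of "{\<phi> i}" "\<phi> ` I"] by auto
  then have "vec.span (\<Union>i\<in>I. l i) \<subseteq> vec.span (\<phi> ` I)"
    by (intro vec.span_minimal) auto
  then show ?thesis
    using assms(1) by auto
qed

theorem lemma1p1:
  fixes n :: nat
    and l :: "nat \<Rightarrow> (complex ^ 'd) set"
    and \<phi> :: "nat \<Rightarrow> complex ^ 'd"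
  assumes "doubly_transitive_lines n l"
    and "vec.span (\<Union>i\<in>{1..n}. l i) = UNIV"
    and "\<And>i. i \<in> {1..n} \<Longrightarrow> \<phi> i \<in> l i"
    and "\<And>i. i \<in> {1..n} \<Longrightarrow> norm (\<phi> i) = 1"
  shows "(\<exists>\<beta>::real. \<forall>i\<in>{1..n}. \<forall>j\<in>{1..n}. i \<noteq> j \<longrightarrow> (cmod (cinner (\<phi> i) (\<phi> j)))\<^sup>2 = \<beta>) \<and>
         (n > CARD('d) \<longrightarrow> (\<exists>\<alpha>::complex. (\<Sum>i\<in>{1..n}. outer_self (\<phi> i)) = mat \<alpha>))"
proof -
  define G where "G i j = cinner (\<phi> i) (\<phi> j)" for i j
  define H where "H i j = (\<Sum>k\<in>{1..n}. G i k * G k j)" for i j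
  have line: "is_line (l i)" if "i \<in> {1..n}" for i
    using assms(1) that by (simp add: doubly_transitive_lines_def)
  \<comment> \<open>A single automorphism serves \<open>G\<close> and \<open>H\<close> with the same
    two phases; on the diagonal of \<open>H\<close> they cancel.\<close>
  have trans: "\<exists>a b. a * cnj a = 1 \<and> b * cnj b = 1 \<and> G i j = a * cnj b * G i' j' \<and>
      H i j = a * cnj b * H i' j' \<and> H i i = H i' i'"
    if ij: "i \<in> {1..n}" "j \<in> {1..n}" "i' \<in> {1..n}" "j' \<in> {1..n}" "i \<noteq> j" "i' \<noteq> j'"
    for i j i' j'
  proof -
    obtain \<sigma> where aut: "line_automorphism n l \<sigma>" and \<sigma>: "\<sigma> i = i'" "\<sigma> j = j'"
      using assms(1) ij unfolding doubly_transitive_lines_def by meson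
    have perm: "\<sigma> permutes {1..n}"
      using aut by (simp add: line_automorphism_def)
    obtain c where c: "\<And>k. k \<in> {1..n} \<Longrightarrow> c k * cnj (c k) = 1"
      and G: "\<And>k m. k \<in> {1..n} \<Longrightarrow> m \<in> {1..n} \<Longrightarrow> G k m = c k * cnj (c m) * G (\<sigma> k) (\<sigma> m)"
      using line_automorphism_phases[OF aut line assms(3,4)] unfolding G_def by blast
    have H: "H k m = c k * cnj (c m) * H (\<sigma> k) (\<sigma> m)" if "k \<in> {1..n}" "m \<in> {1..n}" for k m
    proof -
      have "G k p * G p m = c k * cnj (c m) * (G (\<sigma> k) (\<sigma> p) * G (\<sigma> p) (\<sigma> m))"
        if p: "p \<in> {1..n}" for p
      proof -
        \<comment> \<open>The intermediate index contributes \<open>cnj (c p)\<close> through the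
          first factor and \<open>c p\<close> through the second, so its phase drops out.\<close>
        have "G k p * G p m = (c p * cnj (c p)) * (c k * cnj (c m) * (G (\<sigma> k) (\<sigma> p) * G (\<sigma> p) (\<sigma> m)))"
          using G[OF \<open>k \<in> _\<close> p] G[OF p \<open>m \<in> _\<close>] by simp
        then show ?thesis
          using c[OF p] by simp
      qed
      then have "H k m = (\<Sum>p\<in>{1..n}. c k * cnj (c m) * (G (\<sigma> k) (\<sigma> p) * G (\<sigma> p) (\<sigma> m)))"
        unfolding H_def by (intro sum.cong) auto
      also have "\<dots> = c k * cnj (c m) * (\<Sum>p\<in>{1..n}. G (\<sigma> k) (\<sigma> p) * G (\<sigma> p) (\<sigma> m))"
        by (simp add: sum_distrib_left)
      also have "(\<Sum>p\<in>{1..n}. G (\<sigma> k) (\<sigma> p) * G (\<sigma> p) (\<sigma> m)) = H (\<sigma> k) (\<sigma> m)"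
        unfolding H_def
        using sum.permute[OF perm, of "\<lambda>p. G (\<sigma> k) p * G p (\<sigma> m)"] by (simp add: o_def)
      finally show ?thesis .
    qed
    show ?thesis
      using c[OF ij(1)] c[OF ij(2)] G[OF ij(1,2)] H[OF ij(1,2)] H[OF ij(1,1)] \<sigma>
      by (intro exI[of _ "c i"] exI[of _ "c j"]) simp
  qed
  have "cmod (G i j) = cmod (G i' j')"
    if ij: "i \<in> {1..n}" "j \<in> {1..n}" "i' \<in> {1..n}" "j' \<in> {1..n}" "i \<noteq> j" "i' \<noteq> j'" for i j i' j'
  proof -
    obtain a b where "a * cnj a = 1" "b * cnj b = 1" "G i j = a * cnj b * G i' j'"
      using trans[OF ij] by blast
    moreover from this have "cmod a = 1" "cmod b = 1"
      by (simp_all add: complex_norm_square[symmetric] abs_square_eq_1 flip: of_real_power)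
    ultimately show ?thesis
      by (simp add: norm_mult)
  qed
  then have a: "\<exists>\<beta>. \<forall>i\<in>{1..n}. \<forall>j\<in>{1..n}. i \<noteq> j \<longrightarrow> (cmod (G i j))\<^sup>2 = \<beta>"
    by metis
  \<comment> \<open>The pair \<open>(1, 2)\<close> is a reference: common phases cancel in the ratio
    \<open>H i j / G i j\<close>, so every other pair has the same one.\<close>
  have "(\<Sum>i\<in>{1..n}. outer_self (\<phi> i)) = mat (H 1 2 / G 1 2)" if n: "n > CARD('d)"
  proof (rule sum_outer_self_eq_mat)
    let ?r = "H 1 2 / G 1 2"
    have "n \<ge> 2"
      using n zero_less_card_finite[where 'a = 'd] by linarith
    then have 12: "1 \<in> {1..n}" "2 \<in> {1..n}" "(1::nat) \<noteq> 2"
      by auto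
    have Gii: "G i i = 1" if "i \<in> {1..n}" for i
      using assms(4)[OF that] by (simp add: G_def cinner_self)
    \<comment> \<open>If this entry vanished, so would all off-diagonal ones, and
      \<open>\<phi>\<close> would be an orthonormal family of more than \<open>d\<close>
      vectors.\<close>
    have "G 1 2 \<noteq> 0"
    proof
      assume "G 1 2 = 0"
      then have "G i j = (if i = j then 1 else 0)" if "i \<in> {1..n}" "j \<in> {1..n}" for i j
        using trans[OF that 12(1,2) _ 12(3)] Gii[OF that(1)] by auto
      then have "card {1..n} \<le> CARD('d)"
        by (intro biorthogonal_card_le[of 1 _ \<phi> \<phi>]) (auto simp: G_def)
      then show False
        using n by simp
    qed
    then show "(\<Sum>k\<in>{1..n}. cinner (\<phi> i) (\<phi> k) * cinner (\<phi> k) (\<phi> j)) = ?r * cinner (\<phi> i) (\<phi> j)"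
      if "i \<in> {1..n}" "j \<in> {1..n}" "i \<noteq> j" for i j
      using trans[OF that(1,2) 12(1,2) that(3) 12(3)] unfolding H_def[symmetric] G_def[symmetric]
      by auto
    \<comment> \<open>The constant \<open>e\<close> is read off at index 1, where
      \<open>G 1 1 = 1\<close>.\<close>
    show "(\<Sum>k\<in>{1..n}. cinner (\<phi> i) (\<phi> k) * cinner (\<phi> k) (\<phi> i))
        = ?r * cinner (\<phi> i) (\<phi> i) + (H 1 1 - ?r)" if i: "i \<in> {1..n}" for i
    proof -
      \<comment> \<open>\<open>trans\<close> moves pairs only, so comparing diagonal entries takes
        an auxiliary second index; 1 or 2 will do.\<close>
      have "\<exists>j\<in>{1..n}. i \<noteq> j"
        using 12 by metis
      then have "H i i = H 1 1"
        using trans[OF i _ 12(1,2) _ 12(3)] by blast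
      then show ?thesis
        using Gii[OF i] unfolding H_def[symmetric] G_def[symmetric] by simp
    qed
    show "vec.span (\<phi> ` {1..n}) = UNIV"
      using assms(3,4) line by (intro span_representatives[OF assms(2)]) fastforce+
    show "CARD('d) < card {1..n}"
      using n by simp
  qed
  with a show ?thesis
    unfolding G_def by blast
qed

end
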